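(* Let $\varphi_j=\frac1{j!}$ for even $j\ge0$ and $\varphi_j=0$ for odd $j$ (so $\sum_j\varphi_jt^j=\cosh t$). For $n\ge1$ let $T_n=\sum_{T\in\mathcal{O}(n)}\big(\prod_{v\in T}\varphi_{\mathrm{outdeg}(v)}\big)\ell(T)$ be the number of unordered even-degree bilabelled increasing trees with $2n$ labels, where $\ell(T)$ is the number of increasing bilabellings of $T$ with label set $\{1,\dots,2n\}$, and let $T(z)=\sum_{n\ge1}T_n\frac{z^{2n}}{(2n)!}$. Then \[T'(z)=(1-i)\,\mathrm{sl}\Big(\frac{(1+i)z}{2}\Big),\qquad T_n=\Big(\frac i2\Big)^{n-1}S_{2n-1}\quad(n\ge1),\] and \[T_{n+2}=\frac12\sum_{j+k+\ell=n-1}\binom{2n+1}{2j+1,\,2k+1,\,2\ell+1}T_{j+1}T_{k+1}T_{\ell+1}\quad(n\ge0),\qquad T_1=1.\]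
   Context: $\mathcal{O}(n)$ is the set of ordered (planted plane) rooted trees with $n$ nodes; $\mathrm{outdeg}(v)$ is the number of children of $v$. An increasing bilabelling of a tree with $n$ nodes assigns to each node a set of exactly two integers from $\{1,\dots,2n\}$, these sets partitioning $\{1,\dots,2n\}$, such that every label of a child is larger than both labels of its parent. The lemniscate sine $\mathrm{sl}(z)$ is the inverse of $s\mapsto\int_0^s\frac{dt}{\sqrt{1-t^4}}$, with Taylor expansion $\mathrm{sl}(z)=\sum_{n\ge1}S_n\frac{z^n}{n!}$. *)

theory Defs
  imports "HOL-Complex_Analysis.Complex_Analysis"
begin

datatype otree = Node (children: "otree list")

text \<open>
  Nodes are addressed by paths from the root: the empty path is the root, and \<open>v @ [i]\<close> is
  the \<open>i\<close>-th child (counted from 0) of the node \<open>v\<close>.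
\<close>
fun is_node :: "otree \<Rightarrow> nat list \<Rightarrow> bool" where
  "is_node t [] = True"
| "is_node (Node ts) (i # p) = (i < length ts \<and> is_node (ts ! i) p)"

definition nodes :: "otree \<Rightarrow> nat list set" where
  "nodes t = {v. is_node t v}"

fun outdeg :: "otree \<Rightarrow> nat list \<Rightarrow> nat" where
  "outdeg (Node ts) [] = length ts"
| "outdeg (Node ts) (i # p) = outdeg (ts ! i) p"

definition ordered_trees :: "nat \<Rightarrow> otree set" where
  "ordered_trees n = {t. card (nodes t) = n}"

text \<open>
  Labellings are restricted to be \<open>undefined\<close> off the node set (extensional function space),
  so that they can be counted.
\<close>
definition increasing_bilabellings :: "otree \<Rightarrow> (nat list \<Rightarrow> nat set) set" where
  "increasing_bilabellings t =
     {L \<in> nodes t \<rightarrow>\<^sub>E {A. card A = 2}.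
        disjoint_family_on L (nodes t) \<and>
        (\<Union>v\<in>nodes t. L v) = {1..2 * card (nodes t)} \<and>
        (\<forall>v i. v @ [i] \<in> nodes t \<longrightarrow> (\<forall>a\<in>L v. \<forall>b\<in>L (v @ [i]). a < b))}"

text \<open>
  On the open unit disc \<open>1 - t ^ 4\<close> has positive real part, so the principal branch of the
  square root is holomorphic there and the integral defines an injective holomorphic function.
\<close>
definition arcsl :: "complex \<Rightarrow> complex" where
  "arcsl s = contour_integral (linepath 0 s) (\<lambda>t. 1 / csqrt (1 - t ^ 4))"

text \<open>
  The inverse function on the image of the unit disc, an open neighbourhood of 0. It determines
  the germ at 0, hence the Taylor expansion, of the lemniscate sine; values outside the image
  are arbitrary.
\<close>
definition sl :: "complex \<Rightarrow> complex" where
  "sl = the_inv_into (ball 0 1) arcsl"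

lemma finite_nodes: "finite (nodes t)"
proof (induction t)
  case (Node ts)
  have "nodes (Node ts) \<subseteq> insert [] (\<Union>i<length ts. (#) i ` nodes (ts ! i))"
  proof
    fix v assume "v \<in> nodes (Node ts)"
    then show "v \<in> insert [] (\<Union>i<length ts. (#) i ` nodes (ts ! i))"
      by (cases v) (auto simp: nodes_def)
  qed
  moreover have "finite (insert [] (\<Union>i<length ts. (#) i ` nodes (ts ! i)))"
    using Node by auto
  ultimately show ?case
    by (rule finite_subset)
qed

lemma finite_ordered_trees: "finite (ordered_trees n)"
proof -
  have "finite {t. card (nodes t) \<le> n}"
  proof (induction n)
    case 0
    have "card (nodes t) \<noteq> 0" for t
    proof -
      have "[] \<in> nodes t"
        by (simp add: nodes_def)
      then show ?thesis
        using finite_nodes[of t] by (metis card_0_eq empty_iff)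
    qed
    then have "{t. card (nodes t) \<le> 0} = {}"
      by (metis (mono_tags) Collect_empty_eq le_zero_eq)
    then show ?case
      by (metis finite.emptyI)
  next
    case (Suc n)
    have "t \<in> Node ` {ts. set ts \<subseteq> {t. card (nodes t) \<le> n} \<and> length ts \<le> n}"
      if le: "card (nodes t) \<le> Suc n" for t
    proof (cases t)
      case (Node ts)
      have "card (nodes u) \<le> n" if "u \<in> set ts" for u
      proof -
        from that obtain i where i: "i < length ts" "u = ts ! i"
          by (auto simp: in_set_conv_nth)
        have "insert [] ((#) i ` nodes u) \<subseteq> nodes t"
          using i Node by (auto simp: nodes_def)
        then have "card (insert [] ((#) i ` nodes u)) \<le> card (nodes t)"
          by (rule card_mono[OF finite_nodes])
        moreover have "card (insert [] ((#) i ` nodes u)) = Suc (card (nodes u))"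
          using finite_nodes[of u] by (subst card_insert_disjoint) (auto simp: card_image)
        ultimately show ?thesis
          using le by simp
      qed
      moreover have "length ts \<le> n"
      proof -
        have "insert [] ((\<lambda>i. [i]) ` {..<length ts}) \<subseteq> nodes t"
          using Node by (auto simp: nodes_def)
        then have "card (insert [] ((\<lambda>i. [i]) ` {..<length ts})) \<le> card (nodes t)"
          by (rule card_mono[OF finite_nodes])
        moreover have "card (insert [] ((\<lambda>i. [i]) ` {..<length ts})) = Suc (length ts)"
          by (subst card_insert_disjoint) (auto simp: card_image inj_on_def)
        ultimately show ?thesis
          using le by simp
      qed
      ultimately show ?thesis
        using Node by auto
    qed
    then have "{t. card (nodes t) \<le> Suc n} \<subseteq>
        Node ` {ts. set ts \<subseteq> {t. card (nodes t) \<le> n} \<and> length ts \<le> n}"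
      by blast
    then show ?case
      by (rule finite_subset) (intro finite_imageI finite_lists_length_le Suc.IH)
  qed
  then show ?thesis
    by (rule rev_finite_subset) (auto simp: ordered_trees_def)
qed

lemma Re_one_minus_power4_pos:
  fixes t :: complex
  assumes "t \<in> ball 0 1"
  shows "Re (1 - t ^ 4) > 0"
proof -
  have "Re (t ^ 4) \<le> norm (t ^ 4)"
    by (rule complex_Re_le_cmod)
  also have "norm (t ^ 4) < 1"
    using assms by (simp add: norm_power power_less_one_iff)
  finally show ?thesis
    by simp
qed

lemma arcsl_has_field_derivative:
  assumes "s \<in> ball 0 1"
  shows "(arcsl has_field_derivative 1 / csqrt (1 - s ^ 4)) (at s)"
proof -
  have ne: "1 - t ^ 4 \<notin> \<real>\<^sub>\<le>\<^sub>0" "csqrt (1 - t ^ 4) \<noteq> 0" if "t \<in> ball 0 1" for t :: complex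
    using Re_one_minus_power4_pos[OF that] by (auto simp: complex_nonpos_Reals_iff)
  have "(\<lambda>t. 1 / csqrt (1 - t ^ 4)) holomorphic_on ball 0 1"
    by (intro holomorphic_intros) (use ne in blast)+
  then obtain g where g: "\<And>x. x \<in> ball 0 1 \<Longrightarrow>
      (g has_field_derivative 1 / csqrt (1 - x ^ 4)) (at x within ball 0 1)"
    using holomorphic_convex_primitive'[of "ball 0 1" "\<lambda>t. 1 / csqrt (1 - t ^ 4)"] by auto
  have eq: "g x - g 0 = arcsl x" if "x \<in> ball 0 1" for x
  proof -
    have "path_image (linepath 0 x) \<subseteq> ball 0 1"
      using that by (simp add: closed_segment_subset)
    then show ?thesis
      using contour_integral_primitive[of "ball 0 1" g "\<lambda>t. 1 / csqrt (1 - t ^ 4)" "linepath 0 x"] g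
      by (simp add: arcsl_def contour_integral_unique)
  qed
  have "(g has_field_derivative 1 / csqrt (1 - s ^ 4)) (at s)"
    using g[OF assms] unfolding at_within_open[OF assms open_ball] .
  then have "((\<lambda>x. g x - g 0) has_field_derivative 1 / csqrt (1 - s ^ 4)) (at s)"
    using DERIV_diff[OF _ DERIV_const, of g _ s UNIV "g 0"] by simp
  then show ?thesis
    by (rule has_field_derivative_transform_within_open[OF _ open_ball assms eq])
qed

lemma inj_on_arcsl: "inj_on arcsl (ball 0 1)"
proof (rule inj_onI, rule ccontr)
  fix a b :: complex
  assume ab: "a \<in> ball 0 1" "b \<in> ball 0 1" "arcsl a = arcsl b" "a \<noteq> b"
  have sub: "closed_segment a b \<subseteq> ball 0 1"
    using ab by (simp add: closed_segment_subset)
  have "((\<lambda>z. arcsl z / (b - a)) has_field_derivative (1 / csqrt (1 - u ^ 4)) / (b - a)) (at u)"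
    if "u \<in> closed_segment a b" for u
    using sub that by (intro DERIV_cdivide arcsl_has_field_derivative) auto
  then obtain u where u: "u \<in> closed_segment a b"
    "Re (arcsl b / (b - a)) - Re (arcsl a / (b - a)) = Re ((1 / csqrt (1 - u ^ 4)) / (b - a) * (b - a))"
    using complex_mvt_line[of a b "\<lambda>z. arcsl z / (b - a)" "\<lambda>u. (1 / csqrt (1 - u ^ 4)) / (b - a)"]
    by blast
  then have "Re (1 / csqrt (1 - u ^ 4)) = 0"
    using ab by simp
  moreover have "Re (csqrt (1 - u ^ 4)) > 0"
  proof -
    have "Re (1 - u ^ 4) > 0"
      using Re_one_minus_power4_pos sub u(1) by blast
    then show ?thesis
      using complex_Re_le_cmod[of "1 - u ^ 4"] by (simp add: real_sqrt_gt_zero)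
  qed
  ultimately show False
    by (simp add: Re_divide del: csqrt.simps)
qed

lemma sl_arcsl: "s \<in> ball 0 1 \<Longrightarrow> sl (arcsl s) = s"
  unfolding sl_def by (rule the_inv_into_f_f[OF inj_on_arcsl])


lemma arcsl_of_real:
  assumes "0 \<le> x" "x < 1"
  shows "arcsl (of_real x) = of_real (integral {0..x} (\<lambda>t. 1 / sqrt (1 - t ^ 4)))"
proof (cases "x = 0")
  case True
  then show ?thesis
    by (simp add: arcsl_def)
next
  case False
  have pow: "t ^ 4 < 1" if "t \<in> {0..x}" for t
    using that assms by (simp add: power_less_one_iff)
  have "continuous_on {0..x} (\<lambda>t. 1 / sqrt (1 - t ^ 4))"
    by (intro continuous_intros) (use pow in \<open>auto simp: less_imp_neq\<close>)
  then have "((\<lambda>t. 1 / sqrt (1 - t ^ 4)) has_integral integral {0..x} (\<lambda>t. 1 / sqrt (1 - t ^ 4))) {0..x}"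
    by (intro integrable_integral integrable_continuous_real)
  then have "((\<lambda>t. complex_of_real (1 / sqrt (1 - t ^ 4))) has_integral
      of_real (integral {0..x} (\<lambda>t. 1 / sqrt (1 - t ^ 4)))) {0..x}"
    by (rule has_integral_of_real)
  also have "?this \<longleftrightarrow> ((\<lambda>t. 1 / csqrt (1 - of_real t ^ 4)) has_integral
      of_real (integral {0..x} (\<lambda>t. 1 / sqrt (1 - t ^ 4)))) {0..x}"
  proof (rule has_integral_cong)
    fix t assume "t \<in> {0..x}"
    then have "csqrt (of_real (1 - t ^ 4)) = of_real (sqrt (1 - t ^ 4))"
      using pow[of t] by (intro of_real_sqrt[symmetric]) simp
    then show "complex_of_real (1 / sqrt (1 - t ^ 4)) = 1 / csqrt (1 - of_real t ^ 4)"
      by simp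
  qed
  finally have "((\<lambda>t. 1 / csqrt (1 - t ^ 4)) has_contour_integral
      of_real (integral {0..x} (\<lambda>t. 1 / sqrt (1 - t ^ 4)))) (linepath 0 (of_real x))"
    using assms False by (subst has_contour_integral_linepath_Reals_iff) auto
  then show ?thesis
    unfolding arcsl_def by (rule contour_integral_unique)
qed

end

theory Submission
  imports Defs
begin

text \<open>
  In an increasing bilabelling the root carries the two smallest labels, and the remaining labels
  are distributed freely among the subtrees at the root. Hence the exponential generating function
  satisfies \<open>T'' = cosh T\<close>. Since \<open>(T'\<^sup>2)' = 2 T' cosh T = (2 sinh T)'\<close>, the
  derivative \<open>U = T'\<close> satisfies \<open>U\<^sup>2 = 2 sinh T\<close> and therefore
  \<open>U'' = U sinh T = U\<^sup>3 / 2\<close>, which is the recurrence. Differentiating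
  \<open>sl'\<^sup>2 = 1 - sl\<^sup>4\<close> gives \<open>sl'' = -2 sl\<^sup>3\<close>, so the rescaled function
  \<open>(1 - \<i>) sl ((1 + \<i>) z / 2)\<close> solves the same initial value problem as \<open>U\<close>, and a formal
  power series solution is unique.
\<close>

unbundle no vec_syntax

section \<open>Bilabellings of sets of paths\<close>

text \<open>Both the path set and the label set are arbitrary, because the recursion passes through
  forests, whose paths are not the nodes of a tree, and through subtrees, whose labels need not form
  an initial interval. The guard \<open>v \<in> V\<close> matters for such sets: the parent of a
  path in \<open>V\<close> may lie outside \<open>V\<close>, where \<open>L\<close> is
  \<open>undefined\<close>.\<close>

definition bilab :: "nat list set \<Rightarrow> nat set \<Rightarrow> (nat list \<Rightarrow> nat set) set" where
  "bilab V A = {L \<in> V \<rightarrow>\<^sub>E {B. card B = 2}. disjoint_family_on L V \<and> (\<Union>v\<in>V. L v) = A \<and>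
     (\<forall>v i. v \<in> V \<longrightarrow> v @ [i] \<in> V \<longrightarrow> (\<forall>a\<in>L v. \<forall>b\<in>L (v @ [i]). a < b))}"

lemma is_node_append: "is_node t (v @ w) \<Longrightarrow> is_node t v"
proof (induction v arbitrary: t)
  case (Cons i v)
  then show ?case
    by (cases t) auto
qed simp

text \<open>The node set of a tree is closed under prefixes, so the guard on the parent holds
  automatically.\<close>

lemma increasing_bilabellings_eq_bilab:
  "increasing_bilabellings t = bilab (nodes t) {1..2 * card (nodes t)}"
proof -
  have "v \<in> nodes t" if "v @ [i] \<in> nodes t" for v i
    using that is_node_append by (auto simp: nodes_def)
  then show ?thesis
    unfolding increasing_bilabellings_def bilab_def
    by (intro Collect_cong conj_cong refl) blast
qed

lemma finite_bilab:
  assumes "finite V" "finite A"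
  shows "finite (bilab V A)"
proof (rule finite_subset)
  show "bilab V A \<subseteq> V \<rightarrow>\<^sub>E Pow A"
    by (force simp: bilab_def PiE_iff)
  show "finite (V \<rightarrow>\<^sub>E Pow A)"
    using assms by (intro finite_PiE) auto
qed

lemma card_labels_bilab:
  assumes "L \<in> bilab V A" "finite V"
  shows "card A = 2 * card V"
proof -
  have c: "card (L v) = 2" if "v \<in> V" for v
    using assms(1) that by (auto simp: bilab_def PiE_iff)
  have "card (\<Union>v\<in>V. L v) = (\<Sum>v\<in>V. card (L v))"
  proof (rule card_UN_disjoint)
    show "\<forall>v\<in>V. finite (L v)"
      using c by (metis card.infinite zero_neq_numeral)
    show "\<forall>v\<in>V. \<forall>w\<in>V. v \<noteq> w \<longrightarrow> L v \<inter> L w = {}"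
      using assms(1) by (auto simp: bilab_def disjoint_family_on_def)
  qed fact
  then show ?thesis
    using c assms(1) by (simp add: bilab_def)
qed

section \<open>Invariance under order-preserving relabelling\<close>

text \<open>Applying a strictly increasing map to all labels preserves every condition, and distinct
  bilabellings stay distinct because all their labels lie in \<open>A\<close>, where the map is
  injective.\<close>

lemma card_bilab_image_le:
  assumes "finite V" "finite A" "strict_mono_on A f"
  shows "card (bilab V A) \<le> card (bilab V (f ` A))"
proof (rule card_inj_on_le)
  have inj: "inj_on f A"
    using assms(3) strict_mono_on_imp_inj_on by blast
  show "inj_on (\<lambda>L. \<lambda>v\<in>V. f ` L v) (bilab V A)"
  proof (rule inj_onI)
    fix L M assume LM: "L \<in> bilab V A" "M \<in> bilab V A" "(\<lambda>v\<in>V. f ` L v) = (\<lambda>v\<in>V. f ` M v)"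
    show "L = M"
    proof (rule PiE_ext)
      show "L \<in> V \<rightarrow>\<^sub>E {B. card B = 2}" "M \<in> V \<rightarrow>\<^sub>E {B. card B = 2}"
        using LM by (auto simp: bilab_def)
      fix v assume v: "v \<in> V"
      then have "f ` L v = f ` M v"
        using fun_cong[OF LM(3), of v] by simp
      moreover have "L v \<subseteq> A" "M v \<subseteq> A"
        using LM v by (auto simp: bilab_def)
      ultimately show "L v = M v"
        using inj_on_image_eq_iff[OF inj] by blast
    qed
  qed
  show "(\<lambda>L. \<lambda>v\<in>V. f ` L v) ` bilab V A \<subseteq> bilab V (f ` A)"
  proof (rule image_subsetI)
    fix L assume L: "L \<in> bilab V A"
    have sub: "L v \<subseteq> A" if "v \<in> V" for v
      using L that by (auto simp: bilab_def)
    have "card (f ` L v) = 2" if "v \<in> V" for v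
      using L that card_image[OF inj_on_subset[OF inj sub[OF that]]] by (auto simp: bilab_def PiE_iff)
    moreover have "disjoint_family_on (\<lambda>v\<in>V. f ` L v) V"
      unfolding disjoint_family_on_def
    proof (intro ballI impI)
      fix v w assume vw: "v \<in> V" "w \<in> V" "v \<noteq> w"
      then have "L v \<inter> L w = {}"
        using L by (auto simp: bilab_def disjoint_family_on_def)
      then show "(\<lambda>v\<in>V. f ` L v) v \<inter> (\<lambda>v\<in>V. f ` L v) w = {}"
        using vw inj_on_image_Int[OF inj sub sub, of v w] by simp
    qed
    moreover have "(\<Union>v\<in>V. (\<lambda>v\<in>V. f ` L v) v) = f ` A"
      using L by (auto simp: bilab_def)
    moreover have "f a < f b" if "v \<in> V" "v @ [i] \<in> V" "a \<in> L v" "b \<in> L (v @ [i])" for v i a b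
    proof -
      have "a < b"
        using L that by (auto simp: bilab_def)
      then show ?thesis
        using assms(3) sub that by (meson strict_mono_onD subsetD)
    qed
    ultimately show "(\<lambda>v\<in>V. f ` L v) \<in> bilab V (f ` A)"
      by (auto simp: bilab_def)
  qed
  show "finite (bilab V (f ` A))"
    using assms finite_bilab by simp
qed

text \<open>Both sets are enumerated increasingly by \<open>{..<card A}\<close>; the map is the
  enumeration of \<open>B\<close> after the inverse of that of \<open>A\<close>.\<close>

lemma ex_strict_mono_on_image_eq:
  fixes A B :: "nat set"
  assumes "finite A" "finite B" "card A = card B"
  shows "\<exists>f. strict_mono_on A f \<and> f ` A = B"
proof -
  obtain g where g: "bij_betw g {..<card A} A" "strict_mono_on {..<card A} g"
    by (rule ex_bij_betw_strict_mono_card[OF assms(1)])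
  obtain h where h: "bij_betw h {..<card A} B" "strict_mono_on {..<card A} h"
    unfolding assms(3) by (rule ex_bij_betw_strict_mono_card[OF assms(2)])
  let ?f = "h \<circ> the_inv_into {..<card A} g"
  have "bij_betw ?f A B"
    using g h by (meson bij_betw_the_inv_into bij_betw_trans)
  moreover have "strict_mono_on A ?f"
  proof (rule strict_mono_onI)
    fix x y assume xy: "x \<in> A" "y \<in> A" "x < y"
    obtain i j where ij: "i \<in> {..<card A}" "j \<in> {..<card A}" "x = g i" "y = g j"
      using xy by (metis bij_betw_imp_surj_on[OF g(1)] imageE)
    moreover have "i < j"
      using xy(3) ij strict_mono_onD[OF g(2), of j i] by (cases i j rule: linorder_cases) auto
    ultimately show "?f x < ?f y"
      using strict_mono_onD[OF h(2)] by (simp add: the_inv_into_f_f[OF bij_betw_imp_inj_on[OF g(1)]])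
  qed
  ultimately show ?thesis
    by (auto simp: bij_betw_def)
qed

text \<open>The inequality for relabellings is applied in both directions, from \<open>A\<close> to
  \<open>B\<close> and back.\<close>

lemma card_bilab_cong:
  assumes "finite V" "finite A" "finite B" "card A = card B"
  shows "card (bilab V A) = card (bilab V B)"
proof (rule order_antisym)
  show "card (bilab V A) \<le> card (bilab V B)"
    using card_bilab_image_le[OF assms(1,2)] ex_strict_mono_on_image_eq[OF assms(2-4)] by auto
  show "card (bilab V B) \<le> card (bilab V A)"
    using card_bilab_image_le[OF assms(1,3)] ex_strict_mono_on_image_eq[OF assms(3,2)] assms(4)
    by auto
qed

text \<open>By \<open>sep\<close> no parent-child pair runs between \<open>V\<close> and
  \<open>W\<close>. Once the set \<open>B\<close> of labels used on \<open>V\<close> is chosen, the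
  two restrictions are therefore independent; each node takes two labels, which forces the size of
  \<open>B\<close>.\<close>

lemma card_bilab_Un:
  assumes fin: "finite V" "finite W" and disj: "V \<inter> W = {}"
    and sep: "\<And>v i. v \<in> V \<Longrightarrow> v @ [i] \<notin> W" "\<And>v i. v \<in> W \<Longrightarrow> v @ [i] \<notin> V"
    and A: "finite A"
  shows "card (bilab (V \<union> W) A) =
    (\<Sum>B | B \<subseteq> A \<and> card B = 2 * card V. card (bilab V B) * card (bilab W (A - B)))"
proof -
  let ?f = "\<lambda>L. (\<Union>v\<in>V. L v, restrict L V, restrict L W)"
  let ?g = "\<lambda>(B, L, M). \<lambda>v\<in>V \<union> W. if v \<in> V then L v else M v"
  let ?X = "{B. B \<subseteq> A \<and> card B = 2 * card V}"
  let ?S = "SIGMA B:?X. bilab V B \<times> bilab W (A - B)"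
  have "bij_betw ?f (bilab (V \<union> W) A) ?S"
  proof (rule bij_betw_byWitness[where f' = ?g])
    show "\<forall>L\<in>bilab (V \<union> W) A. ?g (?f L) = L"
      by (auto simp: bilab_def PiE_iff extensional_def fun_eq_iff)
    show "\<forall>x\<in>?S. ?f (?g x) = x"
      using disj by (auto simp: bilab_def PiE_iff extensional_def fun_eq_iff)
    show "?f ` bilab (V \<union> W) A \<subseteq> ?S"
    proof (rule image_subsetI)
      fix L assume L: "L \<in> bilab (V \<union> W) A"
      let ?B = "\<Union>v\<in>V. L v"
      have d: "L v \<inter> L w = {}" if "v \<in> V" "w \<in> W" for v w
      proof -
        have "v \<noteq> w" using that disj by auto
        then show ?thesis using L that by (simp add: bilab_def disjoint_family_on_def)
      qed
      have 1: "restrict L V \<in> bilab V ?B"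
        using L by (auto simp: bilab_def disjoint_family_on_def)
      have "(\<Union>v\<in>W. L v) = A - ?B"
        using L d by (auto simp: bilab_def)
      then have 2: "restrict L W \<in> bilab W (A - ?B)"
        using L by (auto simp: bilab_def disjoint_family_on_def)
      have "?B \<subseteq> A"
        using L by (auto simp: bilab_def)
      then show "?f L \<in> ?S"
        using 1 2 card_labels_bilab[OF 1 fin(1)] by simp
    qed
    show "?g ` ?S \<subseteq> bilab (V \<union> W) A"
    proof (rule image_subsetI)
      fix x assume "x \<in> ?S"
      then obtain B L M where x: "x = (B, L, M)" "B \<subseteq> A" "L \<in> bilab V B" "M \<in> bilab W (A - B)"
        by auto
      have sub: "L v \<subseteq> B" if "v \<in> V" for v
        using x that by (auto simp: bilab_def)
      have sub': "M v \<subseteq> A - B" if "v \<in> W" for v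
        using x that by (auto simp: bilab_def)
      have "disjoint_family_on (?g x) (V \<union> W)"
        unfolding disjoint_family_on_def
      proof (intro ballI impI)
        fix v w assume vw: "v \<in> V \<union> W" "w \<in> V \<union> W" "v \<noteq> w"
        have "L v \<inter> L w = {}" if "v \<in> V" "w \<in> V"
          using x that vw by (auto simp: bilab_def disjoint_family_on_def)
        moreover have "M v \<inter> M w = {}" if "v \<in> W" "w \<in> W"
          using x that vw by (auto simp: bilab_def disjoint_family_on_def)
        ultimately show "?g x v \<inter> ?g x w = {}"
          using vw x sub[of v] sub[of w] sub'[of v] sub'[of w] by auto
      qed
      moreover have "(\<Union>v\<in>V \<union> W. ?g x v) = A"
      proof -
        have "(\<Union>v\<in>V \<union> W. ?g x v) = (\<Union>v\<in>V. L v) \<union> (\<Union>v\<in>W. M v)"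
          using disj x by auto
        then show ?thesis
          using x by (auto simp: bilab_def)
      qed
      moreover have "?g x \<in> V \<union> W \<rightarrow>\<^sub>E {B. card B = 2}"
        using x by (auto simp: bilab_def PiE_iff)
      moreover have "a < b" if "v \<in> V \<union> W" "v @ [i] \<in> V \<union> W" "a \<in> ?g x v" "b \<in> ?g x (v @ [i])" for v i a b
        using that x sep disj by (auto simp: bilab_def split: if_splits)
      ultimately show "?g x \<in> bilab (V \<union> W) A"
        unfolding bilab_def by blast
    qed
  qed
  then have "card (bilab (V \<union> W) A) = card ?S"
    by (rule bij_betw_same_card)
  also have "\<dots> = (\<Sum>B\<in>?X. card (bilab V B \<times> bilab W (A - B)))"
    using A fin by (intro card_SigmaI) (auto intro!: finite_bilab intro: finite_subset)
  finally show ?thesis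
    by (simp add: card_cartesian_product)
qed

text \<open>Children are formed by appending at the end of a path, so a common first entry leaves
  the parent relation intact.\<close>

lemma card_bilab_Cons: "card (bilab ((#) i ` V) A) = card (bilab V A)"
proof -
  let ?f = "\<lambda>L. \<lambda>v\<in>(#) i ` V. L (tl v)"
  let ?g = "\<lambda>L. \<lambda>v\<in>V. L (i # v)"
  have "bij_betw ?f (bilab V A) (bilab ((#) i ` V) A)"
  proof (rule bij_betw_byWitness[where f' = ?g])
    show "\<forall>L\<in>bilab V A. ?g (?f L) = L"
      by (auto simp: bilab_def PiE_iff extensional_def fun_eq_iff)
    show "\<forall>L\<in>bilab ((#) i ` V) A. ?f (?g L) = L"
      by (auto simp: bilab_def PiE_iff extensional_def fun_eq_iff)
    show "?f ` bilab V A \<subseteq> bilab ((#) i ` V) A"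
    proof (rule image_subsetI)
      fix L assume L: "L \<in> bilab V A"
      then have "disjoint_family_on (?f L) ((#) i ` V)"
        by (force simp: bilab_def disjoint_family_on_def)
      with L show "?f L \<in> bilab ((#) i ` V) A"
        by (auto simp: bilab_def PiE_iff)
    qed
    show "?g ` bilab ((#) i ` V) A \<subseteq> bilab V A"
    proof (rule image_subsetI)
      fix L assume L: "L \<in> bilab ((#) i ` V) A"
      have "a < b" if "v \<in> V" "v @ [j] \<in> V" "a \<in> L (i # v)" "b \<in> L (i # v @ [j])" for v j a b
      proof -
        have "i # v \<in> (#) i ` V" "(i # v) @ [j] \<in> (#) i ` V"
          using that by auto
        then show ?thesis
          using L that unfolding bilab_def by fastforce
      qed
      moreover have "disjoint_family_on (?g L) V"
        using L by (force simp: bilab_def disjoint_family_on_def)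
      ultimately show "?g L \<in> bilab V A"
        using L by (auto simp: bilab_def PiE_iff)
    qed
  qed
  then show ?thesis
    by (rule bij_betw_same_card[symmetric])
qed

text \<open>Labels increase along every path from the root, so each label elsewhere exceeds both
  root labels. If 1 or 2 sat elsewhere, both root labels would be below 2, leaving room for just
  one.\<close>

lemma bilab_root:
  assumes L: "L \<in> bilab V {1..2 + m}" and root: "[] \<in> V"
    and closed: "\<And>v i. v @ [i] \<in> V \<Longrightarrow> v \<in> V"
  shows "L [] = {1, 2}"
proof -
  have less: "a < b" if "w \<in> V" "w \<noteq> []" "a \<in> L []" "b \<in> L w" for w a b
    using that
  proof (induction w arbitrary: b rule: rev_induct)
    case (snoc i w)
    have w: "w \<in> V"
      using closed snoc.prems by blast
    then have step: "c < b" if "c \<in> L w" for c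
      using L snoc.prems that by (auto simp: bilab_def)
    show ?case
    proof (cases "w = []")
      case True
      then show ?thesis using step snoc.prems by simp
    next
      case False
      \<comment> \<open>Some label of the parent \<open>w\<close> is required as an intermediate
        value to chain the two inequalities.\<close>
      have "L w \<noteq> {}"
        using L w by (force simp: bilab_def PiE_iff)
      then show ?thesis
        using step snoc.IH[OF w False snoc.prems(3)] by (meson ex_in_conv less_trans)
    qed
  qed simp
  have card: "card (L []) = 2"
    using L root by (auto simp: bilab_def PiE_iff)
  have sub: "L [] \<subseteq> {1..2 + m}"
    using L root by (auto simp: bilab_def)
  have mem: "x \<in> L []" if x: "x \<in> {1, 2}" for x
  proof (rule ccontr)
    assume nin: "x \<notin> L []"
    have "x \<in> (\<Union>v\<in>V. L v)"
      using L x by (auto simp: bilab_def)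
    then obtain w where w: "w \<in> V" "x \<in> L w"
      by blast
    then have "w \<noteq> []"
      using nin by metis
    \<comment> \<open>Root labels are at least 1 and lie below \<open>x\<close>, which is at most
      2.\<close>
    then have "L [] \<subseteq> {1}"
      using less[OF w(1) _ _ w(2)] sub x by fastforce
    then have "card (L []) \<le> card {1::nat}"
      by (intro card_mono) auto
    then show False
      using card by simp
  qed
  then have "{1, 2} \<subseteq> L []"
    by auto
  moreover have "finite (L [])"
    using card by (metis card.infinite zero_neq_numeral)
  ultimately show ?thesis
    using card card_subset_eq[of "L []" "{1, 2}"] by simp
qed

text \<open>The root must carry 1 and 2, and all other labels are larger, so the condition between
  the root and its children imposes nothing on the rest. Deleting the root is thus a bijection,
  inverted by assigning \<open>{1, 2}\<close> to the empty path.\<close>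

lemma card_bilab_insert_root:
  assumes fin: "finite V" and nil: "[] \<notin> V"
    and closed: "\<And>v i. v @ [i] \<in> V \<Longrightarrow> v \<in> insert [] V"
  shows "card (bilab (insert [] V) {1..2 + m}) = card (bilab V {3..2 + m})"
proof -
  let ?f = "\<lambda>L. restrict L V"
  let ?g = "\<lambda>L. L([] := {1, 2::nat})"
  have root: "L [] = {1, 2}" if "L \<in> bilab (insert [] V) {1..2 + m}" for L
    using bilab_root[OF that] closed by blast
  have "bij_betw ?f (bilab (insert [] V) {1..2 + m}) (bilab V {3..2 + m})"
  proof (rule bij_betw_byWitness[where f' = ?g])
    show "\<forall>L\<in>bilab (insert [] V) {1..2 + m}. ?g (?f L) = L"
    proof
      fix L assume L: "L \<in> bilab (insert [] V) {1..2 + m}"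
      then show "?g (?f L) = L"
        using root[OF L] by (auto simp: bilab_def PiE_iff extensional_def fun_eq_iff)
    qed
    show "\<forall>L\<in>bilab V {3..2 + m}. ?f (?g L) = L"
      using nil by (auto simp: bilab_def PiE_iff extensional_def fun_eq_iff)
    show "?f ` bilab (insert [] V) {1..2 + m} \<subseteq> bilab V {3..2 + m}"
    proof (rule image_subsetI)
      fix L assume L: "L \<in> bilab (insert [] V) {1..2 + m}"
      have d: "L v \<inter> {1, 2} = {}" if "v \<in> V" for v
      proof -
        have "v \<noteq> []" using nil that by metis
        then show ?thesis
          using L that root[OF L] by (auto simp: bilab_def disjoint_family_on_def)
      qed
      have "{1, 2} \<union> (\<Union>v\<in>V. L v) = {1..2 + m}"
        using L root[OF L] by (auto simp: bilab_def)
      then have "(\<Union>v\<in>V. L v) = {1..2 + m} - {1, 2}"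
        using d by blast
      also have "\<dots> = {3..2 + m}"
        by auto
      finally show "?f L \<in> bilab V {3..2 + m}"
        using L by (auto simp: bilab_def disjoint_family_on_def PiE_iff)
    qed
    show "?g ` bilab V {3..2 + m} \<subseteq> bilab (insert [] V) {1..2 + m}"
    proof (rule image_subsetI)
      fix L assume L: "L \<in> bilab V {3..2 + m}"
      have sub: "L v \<subseteq> {3..2 + m}" if "v \<in> V" for v
        using L that by (auto simp: bilab_def)
      have 1: "?g L \<in> insert [] V \<rightarrow>\<^sub>E {B. card B = 2}"
        using L by (auto simp: bilab_def PiE_iff extensional_def)
      have 2: "disjoint_family_on (?g L) (insert [] V)"
        unfolding disjoint_family_on_def
      proof (intro ballI impI)
        fix v w assume vw: "v \<in> insert [] V" "w \<in> insert [] V" "v \<noteq> w"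
        have d: "{1, 2} \<inter> L u = {}" if "u \<in> V" for u
          using sub[OF that] by auto
        show "?g L v \<inter> ?g L w = {}"
        proof (cases "v = [] \<or> w = []")
          case True
          then show ?thesis
            using vw d[of v] d[of w] by auto
        next
          case False
          then show ?thesis
            using vw L by (simp add: bilab_def disjoint_family_on_def)
        qed
      qed
      have 3: "(\<Union>v\<in>insert [] V. ?g L v) = {1..2 + m}"
      proof -
        have "(\<Union>v\<in>insert [] V. ?g L v) = {1, 2} \<union> (\<Union>v\<in>V. L v)"
          using nil by auto
        also have "(\<Union>v\<in>V. L v) = {3..2 + m}"
          using L by (simp add: bilab_def)
        also have "{1, 2} \<union> {3..2 + m} = {1..2 + m}"
          by auto
        finally show ?thesis .
      qed
      have 4: "a < b" if v: "v \<in> insert [] V" "v @ [i] \<in> insert [] V" "a \<in> ?g L v" "b \<in> ?g L (v @ [i])" for v i a b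
      proof (cases "v = []")
        case True
        then show ?thesis using v sub[of "[i]"] by auto
      next
        case False
        then show ?thesis using v L by (auto simp: bilab_def)
      qed
      show "?g L \<in> bilab (insert [] V) {1..2 + m}"
        unfolding bilab_def mem_Collect_eq by (intro conjI allI impI ballI 1 2 3 4)
    qed
  qed
  then show ?thesis
    using bij_betw_same_card by blast
qed


section \<open>The generating function of weighted trees\<close>

text \<open>The count in exponential normalisation: dividing by the factorial of the number of
  labels makes the weight multiplicative over unconnected parts.\<close>

definition bilab_weight :: "nat list set \<Rightarrow> 'a::field_char_0" where
  "bilab_weight V = of_nat (card (bilab V {1..2 * card V})) / fact (2 * card V)"

lemma bilab_weight_empty: "bilab_weight {} = 1"
  by (simp add: bilab_weight_def bilab_def disjoint_family_on_def)

lemma bilab_weight_Cons: "bilab_weight ((#) i ` V) = bilab_weight V"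
  by (simp add: bilab_weight_def card_bilab_Cons card_image)

text \<open>All terms of the sum over label sets are equal by relabelling, so the sum is a binomial
  coefficient times a product; the normalising factorials absorb the binomial coefficient.\<close>

lemma bilab_weight_Un:
  assumes fin: "finite V" "finite W" and disj: "V \<inter> W = {}"
    and sep: "\<And>v i. v \<in> V \<Longrightarrow> v @ [i] \<notin> W" "\<And>v i. v \<in> W \<Longrightarrow> v @ [i] \<notin> V"
  shows "(bilab_weight (V \<union> W) :: 'a::field_char_0) = bilab_weight V * bilab_weight W"
proof -
  let ?m = "2 * card V" and ?n = "2 * card W"
  let ?A = "{1..?m + ?n}"
  have "card (bilab (V \<union> W) ?A) =
      (\<Sum>B | B \<subseteq> ?A \<and> card B = ?m. card (bilab V B) * card (bilab W (?A - B)))"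
    by (rule card_bilab_Un[OF fin disj sep]) auto
  also have "\<dots> = (\<Sum>B | B \<subseteq> ?A \<and> card B = ?m. card (bilab V {1..?m}) * card (bilab W {1..?n}))"
  proof (rule sum.cong[OF refl])
    fix B assume "B \<in> {B. B \<subseteq> ?A \<and> card B = ?m}"
    then have B: "B \<subseteq> ?A" "card B = ?m" "finite B"
      by (auto intro: finite_subset)
    then have "card (?A - B) = ?n"
      by (simp add: card_Diff_subset)
    with B have "card (bilab V B) = card (bilab V {1..?m})"
      "card (bilab W (?A - B)) = card (bilab W {1..?n})"
      using fin by (intro card_bilab_cong; simp)+
    then show "card (bilab V B) * card (bilab W (?A - B)) =
        card (bilab V {1..?m}) * card (bilab W {1..?n})"
      by simp
  qed
  also have "\<dots> = ((?m + ?n) choose ?m) * (card (bilab V {1..?m}) * card (bilab W {1..?n}))"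
    by (simp add: n_subsets)
  finally have "(of_nat (card (bilab (V \<union> W) ?A)) :: 'a) =
      of_nat ((?m + ?n) choose ?m) * (of_nat (card (bilab V {1..?m})) * of_nat (card (bilab W {1..?n})))"
    by simp
  also have "of_nat ((?m + ?n) choose ?m) = (fact (?m + ?n) / (fact ?m * fact ?n) :: 'a)"
    by (subst binomial_fact) auto
  finally show ?thesis
    using card_Un_disjoint[OF fin disj] by (simp add: bilab_weight_def divide_simps)
qed

text \<open>Deleting the root preserves the count and lowers the factorial by two steps. The
  quotient of the factorials is the factor that a second derivative produces.\<close>

lemma bilab_weight_insert_root:
  assumes "finite V" "[] \<notin> V" "\<And>v i. v @ [i] \<in> V \<Longrightarrow> v \<in> insert [] V"
  shows "(bilab_weight (insert [] V) :: 'a::field_char_0) =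
    bilab_weight V / (of_nat (2 * card V + 2) * of_nat (2 * card V + 1))"
proof -
  have "card (bilab (insert [] V) {1..2 + 2 * card V}) = card (bilab V {3..2 + 2 * card V})"
    by (rule card_bilab_insert_root[OF assms])
  also have "\<dots> = card (bilab V {1..2 * card V})"
    using assms by (intro card_bilab_cong) auto
  finally show ?thesis
    using assms by (simp add: bilab_weight_def algebra_simps)
qed

section \<open>Weights of trees and forests\<close>

definition forest_nodes :: "otree list \<Rightarrow> nat list set" where
  "forest_nodes ts = (\<Union>i<length ts. (#) i ` nodes (ts ! i))"

lemma finite_forest_nodes: "finite (forest_nodes ts)"
  by (simp add: forest_nodes_def finite_nodes)

lemma nodes_Node: "nodes (Node ts) = insert [] (forest_nodes ts)"
proof -
  have "v \<in> nodes (Node ts) \<longleftrightarrow> v \<in> insert [] (forest_nodes ts)" for v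
    by (cases v) (auto simp: nodes_def forest_nodes_def)
  then show ?thesis by blast
qed

lemma Nil_notin_forest_nodes: "[] \<notin> forest_nodes ts"
  by (auto simp: forest_nodes_def)

lemma forest_nodes_snoc:
  "forest_nodes (ts @ [t]) = forest_nodes ts \<union> (#) (length ts) ` nodes t"
proof -
  have "{..<length (ts @ [t])} = insert (length ts) {..<length ts}"
    by auto
  then show ?thesis
    by (auto simp: forest_nodes_def nth_append)
qed

lemma forest_nodes_snoc_disjoint:
  "forest_nodes ts \<inter> (#) (length ts) ` nodes t = {}"
  by (auto simp: forest_nodes_def)

lemma card_forest_nodes: "card (forest_nodes ts) = (\<Sum>t\<leftarrow>ts. card (nodes t))"
proof (induction ts rule: rev_induct)
  case (snoc t ts)
  then show ?case
    by (simp add: forest_nodes_snoc card_Un_disjoint forest_nodes_snoc_disjoint finite_nodes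
        finite_forest_nodes card_image)
qed (simp add: forest_nodes_def)

lemma card_nodes_Node: "card (nodes (Node ts)) = Suc (\<Sum>t\<leftarrow>ts. card (nodes t))"
  by (simp add: nodes_Node finite_forest_nodes Nil_notin_forest_nodes card_forest_nodes)

text \<open>Paths in different trees have different first entries, and the empty path is absent, so
  the trees are unconnected and the weight is multiplicative. The induction appends trees on the
  right, which keeps the addresses of the earlier trees.\<close>

lemma bilab_weight_forest:
  "bilab_weight (forest_nodes ts) = (\<Prod>t\<leftarrow>ts. bilab_weight (nodes t))"
proof (induction ts rule: rev_induct)
  case Nil
  then show ?case
    by (simp add: forest_nodes_def bilab_weight_empty)
next
  case (snoc t ts)
  have "bilab_weight (forest_nodes (ts @ [t])) =
      bilab_weight (forest_nodes ts) * (bilab_weight ((#) (length ts) ` nodes t) :: 'a)"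
    unfolding forest_nodes_snoc
    by (rule bilab_weight_Un)
       (auto simp: forest_nodes_def finite_nodes Cons_eq_append_conv)
  then show ?case
    by (simp add: snoc.IH bilab_weight_Cons)
qed

lemma prod_forest_outdeg:
  "(\<Prod>v\<in>forest_nodes ts. f (outdeg (Node ts) v)) =
    (\<Prod>t\<leftarrow>ts. \<Prod>v\<in>nodes t. (f (outdeg t v) :: 'a::comm_monoid_mult))"
proof (induction ts rule: rev_induct)
  case (snoc t ts)
  have "(\<Prod>v\<in>forest_nodes (ts @ [t]). f (outdeg (Node (ts @ [t])) v)) =
      (\<Prod>v\<in>forest_nodes ts. f (outdeg (Node (ts @ [t])) v)) *
      (\<Prod>v\<in>(#) (length ts) ` nodes t. f (outdeg (Node (ts @ [t])) v))"
    unfolding forest_nodes_snoc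
    by (rule prod.union_disjoint)
       (auto simp: finite_nodes finite_forest_nodes forest_nodes_snoc_disjoint)
  also have "(\<Prod>v\<in>forest_nodes ts. f (outdeg (Node (ts @ [t])) v)) =
      (\<Prod>v\<in>forest_nodes ts. f (outdeg (Node ts) v))"
    by (rule prod.cong) (auto simp: forest_nodes_def nth_append)
  also have "(\<Prod>v\<in>(#) (length ts) ` nodes t. f (outdeg (Node (ts @ [t])) v)) =
      (\<Prod>v\<in>nodes t. f (outdeg t v))"
    by (subst prod.reindex) (auto simp: comp_def)
  finally show ?case
    by (simp add: snoc.IH)
qed (simp add: forest_nodes_def)

text \<open>The contribution of one tree to its coefficient of the exponential generating function,
  with the factorial already included.\<close>

definition tree_weight :: "(nat \<Rightarrow> 'a::field_char_0) \<Rightarrow> otree \<Rightarrow> 'a" where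
  "tree_weight \<phi> t = (\<Prod>v\<in>nodes t. \<phi> (outdeg t v)) * bilab_weight (nodes t)"

lemma prod_list_mult_map:
  "(\<Prod>x\<leftarrow>xs. f x * g x) = (\<Prod>x\<leftarrow>xs. f x) * (\<Prod>x\<leftarrow>xs. (g x :: 'a::comm_monoid_mult))"
  by (induction xs) (auto simp: ac_simps)

text \<open>Removing the root contributes its degree factor and the factorial quotient; what remains
  is a forest, over which both the degree product and the bilabelling weight factor.\<close>

lemma tree_weight_Node:
  fixes \<phi> :: "nat \<Rightarrow> 'a::field_char_0"
  assumes m: "m = 2 * (\<Sum>t\<leftarrow>ts. card (nodes t))"
  shows "of_nat (m + 2) * of_nat (m + 1) * tree_weight \<phi> (Node ts) =
    \<phi> (length ts) * (\<Prod>t\<leftarrow>ts. tree_weight \<phi> t)"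
proof -
  have "v \<in> insert [] (forest_nodes ts)" if "v @ [i] \<in> forest_nodes ts" for v i
    using that is_node_append[of "Node ts" v "[i]"] nodes_Node[of ts] by (auto simp: nodes_def)
  from bilab_weight_insert_root[OF finite_forest_nodes Nil_notin_forest_nodes this]
  have "(bilab_weight (nodes (Node ts)) :: 'a) =
      (\<Prod>t\<leftarrow>ts. bilab_weight (nodes t)) / (of_nat (m + 2) * of_nat (m + 1))"
    by (simp only: nodes_Node bilab_weight_forest card_forest_nodes m)
  moreover have "(of_nat (m + 2) * of_nat (m + 1) :: 'a) \<noteq> 0"
    unfolding mult_eq_0_iff of_nat_eq_0_iff by simp
  moreover have "(\<Prod>v\<in>nodes (Node ts). \<phi> (outdeg (Node ts) v)) =
      \<phi> (length ts) * (\<Prod>t\<leftarrow>ts. \<Prod>v\<in>nodes t. \<phi> (outdeg t v))"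
    by (simp add: nodes_Node finite_forest_nodes Nil_notin_forest_nodes prod_forest_outdeg)
  ultimately show ?thesis
    by (simp add: tree_weight_def prod_list_mult_map del: of_nat_add of_nat_mult)
qed

text \<open>The exponent counts labels rather than nodes, hence the factor 2.\<close>

definition tree_fps :: "(nat \<Rightarrow> 'a::field_char_0) \<Rightarrow> 'a fps" where
  "tree_fps \<phi> = Abs_fps (\<lambda>m. \<Sum>t | 2 * card (nodes t) = m. tree_weight \<phi> t)"

lemma card_nodes_pos: "card (nodes t) > 0"
  by (cases t) (simp add: card_nodes_Node)

lemma finite_trees_of_size: "finite {t. 2 * card (nodes t) = m}"
  by (rule finite_subset[OF _ finite_ordered_trees[of "m div 2"]]) (auto simp: ordered_trees_def)

abbreviation forest_size :: "otree list \<Rightarrow> nat" where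
  "forest_size ts \<equiv> (\<Sum>t\<leftarrow>ts. card (nodes t))"

lemma length_le_forest_size: "length ts \<le> forest_size ts"
proof (induction ts)
  case (Cons t ts)
  then show ?case
    using card_nodes_pos[of t] by simp
qed simp

lemma finite_forests: "finite {ts. length ts = k \<and> 2 * forest_size ts = m}"
proof (rule finite_subset)
  have "card (nodes t) \<le> forest_size ts" if "t \<in> set ts" for t ts
    using that by (intro member_le_sum_list) auto
  then show "{ts. length ts = k \<and> 2 * forest_size ts = m} \<subseteq>
      {ts. set ts \<subseteq> (\<Union>n\<le>m. ordered_trees n) \<and> length ts = k}"
    by (fastforce simp: ordered_trees_def)
  show "finite {ts. set ts \<subseteq> (\<Union>n\<le>m. ordered_trees n) \<and> length ts = k}"
    by (intro finite_lists_length_eq finite_UN_I finite_ordered_trees) auto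
qed

text \<open>A power of the series enumerates sequences of trees: in the induction, the Cauchy
  product splits a sequence into its head, carrying \<open>i\<close> labels, and its tail.\<close>

lemma tree_fps_power_nth:
  fixes \<phi> :: "nat \<Rightarrow> 'a::field_char_0"
  shows "(tree_fps \<phi> ^ k) $ m =
    (\<Sum>ts | length ts = k \<and> 2 * forest_size ts = m. \<Prod>t\<leftarrow>ts. tree_weight \<phi> t)"
proof (induction k arbitrary: m)
  case 0
  have "{ts :: otree list. length ts = 0 \<and> 2 * forest_size ts = m} = (if m = 0 then {[]} else {})"
    by auto
  then show ?case
    by simp
next
  case (Suc k)
  let ?T = "\<lambda>i. {t. 2 * card (nodes t) = i}"
  let ?L = "\<lambda>k m. {ts. length ts = k \<and> 2 * forest_size ts = m}"
  let ?w = "\<lambda>ts. \<Prod>t\<leftarrow>ts. tree_weight \<phi> t"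
  have "tree_fps \<phi> ^ Suc k $ m = (\<Sum>i=0..m. (\<Sum>t\<in>?T i. tree_weight \<phi> t) * (\<Sum>ts\<in>?L k (m - i). ?w ts))"
    unfolding power_Suc fps_mult_nth Suc.IH by (simp add: tree_fps_def)
  also have "\<dots> = (\<Sum>i=0..m. \<Sum>x\<in>?T i \<times> ?L k (m - i). ?w (fst x # snd x))"
    by (simp add: sum_product sum.cartesian_product case_prod_beta)
  also have "\<dots> = (\<Sum>x\<in>(SIGMA i:{0..m}. ?T i \<times> ?L k (m - i)). ?w (fst (snd x) # snd (snd x)))"
    by (subst sum.Sigma) (auto simp: finite_trees_of_size finite_forests case_prod_beta)
  also have "\<dots> = (\<Sum>ts\<in>?L (Suc k) m. ?w ts)"
    by (rule sum.reindex_bij_witness[where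
          i = "\<lambda>ts. (2 * card (nodes (hd ts)), hd ts, tl ts)" and j = "\<lambda>x. fst (snd x) # snd (snd x)"])
       (auto simp: length_Suc_conv)
  finally show ?case .
qed

text \<open>Cutting off the root turns a tree into the sequence of its subtrees. Sorting these
  sequences by length gives the terms of the composition.\<close>

lemma fps_deriv_deriv_tree_fps:
  "fps_deriv (fps_deriv (tree_fps \<phi>)) = Abs_fps \<phi> oo tree_fps \<phi>"
proof (rule fps_ext)
  fix m
  let ?L = "\<lambda>k. {ts. length ts = k \<and> 2 * forest_size ts = m}"
  let ?M = "{ts. 2 * forest_size ts = m}"
  let ?w = "\<lambda>ts. \<Prod>t\<leftarrow>ts. tree_weight \<phi> t"
  \<comment> \<open>The root accounts for the two extra labels.\<close>
  have "bij_betw Node ?M {t. 2 * card (nodes t) = m + 2}"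
  proof (rule bij_betw_byWitness[where f' = children])
    have "2 * forest_size (children t) = m" if "2 * card (nodes t) = m + 2" for t
      using that by (cases t) (simp add: card_nodes_Node)
    then show "children ` {t. 2 * card (nodes t) = m + 2} \<subseteq> ?M"
      by blast
  qed (auto simp: card_nodes_Node)
  then have "fps_deriv (fps_deriv (tree_fps \<phi>)) $ m =
      of_nat (m + 2) * of_nat (m + 1) * (\<Sum>ts\<in>?M. tree_weight \<phi> (Node ts))"
    by (simp add: tree_fps_def sum.reindex_bij_betw mult_ac)
  also have "\<dots> = (\<Sum>ts\<in>?M. \<phi> (length ts) * ?w ts)"
    unfolding sum_distrib_left by (intro sum.cong refl tree_weight_Node) auto
  \<comment> \<open>Every tree has a node, so a forest with \<open>m\<close> labels has at most
    \<open>m\<close> trees; this matches the finite range of the coefficient formula for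
    compositions.\<close>
  also have "?M = (\<Union>k\<in>{0..m}. ?L k)"
    using length_le_forest_size by (fastforce intro: order_trans)
  also have "(\<Sum>ts\<in>\<dots>. \<phi> (length ts) * ?w ts) = (\<Sum>k=0..m. \<Sum>ts\<in>?L k. \<phi> (length ts) * ?w ts)"
    by (rule sum.UNION_disjoint) (auto simp: finite_forests)
  also have "\<dots> = (\<Sum>k=0..m. \<phi> k * (tree_fps \<phi> ^ k) $ m)"
    by (simp add: tree_fps_power_nth sum_distrib_left)
  finally show "fps_deriv (fps_deriv (tree_fps \<phi>)) $ m = (Abs_fps \<phi> oo tree_fps \<phi>) $ m"
    by (simp add: fps_compose_nth)
qed


section \<open>Formal differential equations\<close>

lemma fps_power_nth_cong:
  fixes f g :: "'a::comm_semiring_1 fps"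
  assumes "\<And>i. i \<le> m \<Longrightarrow> f $ i = g $ i"
  shows "(f ^ k) $ m = (g ^ k) $ m"
proof -
  have "j \<le> m \<Longrightarrow> (f ^ k) $ j = (g ^ k) $ j" for j
  proof (induction k arbitrary: j)
    case (Suc k)
    then show ?case
      using assms by (auto simp: fps_mult_nth intro!: sum.cong)
  qed simp
  then show ?thesis by simp
qed

text \<open>Coefficient \<open>m\<close> of the equation expresses coefficient \<open>m + 2\<close>
  of a solution through those up to \<open>m\<close>, since \<open>(m + 1) * (m + 2)\<close> is
  invertible in characteristic 0.\<close>

lemma fps_second_order_ode_unique:
  fixes f g :: "'a::field_char_0 fps"
  assumes f: "fps_deriv (fps_deriv f) = fps_const c * f ^ k"
    and g: "fps_deriv (fps_deriv g) = fps_const c * g ^ k"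
    and "f $ 0 = g $ 0" "f $ 1 = g $ 1"
  shows "f = g"
proof (rule fps_ext)
  fix n show "f $ n = g $ n"
  proof (induction n rule: less_induct)
    case (less n)
    consider "n = 0" | "n = 1" | m where "n = m + 2"
      by (metis add_2_eq_Suc' less_2_cases not_less_eq not0_implies_Suc One_nat_def numeral_2_eq_2)
    then show ?case
    proof cases
      case 3
      have "fps_deriv (fps_deriv f) $ m = fps_deriv (fps_deriv g) $ m"
        unfolding f g using less 3 by (auto intro!: fps_power_nth_cong)
      then have "of_nat (Suc m) * (of_nat (Suc (Suc m)) * f $ n) =
          of_nat (Suc m) * (of_nat (Suc (Suc m)) * g $ n)"
        using 3 by (simp del: of_nat_Suc)
      then show ?thesis
        by (simp del: of_nat_Suc)
    qed (use assms in simp_all)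
  qed
qed

text \<open>With \<open>C\<close> and \<open>S\<close> the series of cosh and sinh, the first
  integral \<open>U ^ 2 = 2 * (S oo F)\<close> eliminates the composition from
  \<open>U'' = (S oo F) * U\<close>.\<close>

lemma fps_cosh_sinh_ode:
  fixes F :: "'a::field_char_0 fps"
  assumes F: "fps_deriv (fps_deriv F) = Abs_fps (\<lambda>j. if even j then 1 / fact j else 0) oo F"
    and F0: "F $ 0 = 0" and F1: "F $ 1 = 0"
  shows "fps_deriv (fps_deriv (fps_deriv F)) = fps_const (1 / 2) * fps_deriv F ^ 3"
proof -
  define C :: "'a fps" where "C = Abs_fps (\<lambda>j. if even j then 1 / fact j else 0)"
  define S :: "'a fps" where "S = Abs_fps (\<lambda>j. if odd j then 1 / fact j else 0)"
  define U where "U = fps_deriv F"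
  have fact_Suc': "of_nat (Suc n) / fact (Suc n) = (1 / fact n :: 'a)" for n
    by (simp add: field_simps del: of_nat_Suc)
  have C': "fps_deriv C = S" and S': "fps_deriv S = C"
    by (rule fps_ext; simp add: C_def S_def fact_Suc' del: of_nat_Suc fact_Suc)+
  have U': "fps_deriv U = C oo F"
    using F by (simp add: U_def C_def)
  have "fps_deriv (U ^ 2) = fps_deriv (2 * (S oo F))"
    using F0 by (simp add: power2_eq_square U' S' fps_compose_deriv U_def[symmetric] algebra_simps)
  \<comment> \<open>Equal derivatives leave equality of constant terms: the left one vanishes by
    \<open>F1\<close>, the right one because sinh is odd.\<close>
  then have U2: "U ^ 2 = 2 * (S oo F)"
    unfolding fps_deriv_eq_iff using F1 by (simp add: U_def S_def power2_eq_square)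
  have "fps_deriv (fps_deriv U) = (S oo F) * U"
    using F0 by (simp add: U' C' fps_compose_deriv U_def[symmetric])
  also have "S oo F = fps_const (1 / 2) * U ^ 2"
    unfolding U2 mult.assoc[symmetric] numeral_fps_const fps_const_mult by simp
  finally show ?thesis
    by (simp add: U_def power3_eq_cube power2_eq_square mult.assoc)
qed

section \<open>Coefficients of cubes\<close>

lemma finite_sum_triples: "finite {(a, b, c). a + b + c + k = (M::nat)}"
  by (rule finite_subset[of _ "{..M} \<times> {..M} \<times> {..M}"]) auto

lemma fps_cube_nth:
  fixes f :: "'a::comm_semiring_1 fps"
  shows "(f ^ 3) $ M = (\<Sum>(a, b, c)\<in>{(a, b, c). a + b + c = M}. f $ a * f $ b * f $ c)"
proof -
  have "f ^ 3 = f * (f * f)"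
    by (simp add: power3_eq_cube mult.assoc)
  then have "(f ^ 3) $ M = (\<Sum>a=0..M. \<Sum>b=0..M - a. f $ a * f $ b * f $ (M - a - b))"
    by (simp add: fps_mult_nth sum_distrib_left mult.assoc)
  also have "\<dots> = (\<Sum>(a, b)\<in>(SIGMA a:{0..M}. {0..M - a}). f $ a * f $ b * f $ (M - a - b))"
    by (rule sum.Sigma) auto
  also have "\<dots> = (\<Sum>(a, b, c)\<in>{(a, b, c). a + b + c = M}. f $ a * f $ b * f $ c)"
    by (rule sum.reindex_bij_witness[where i = "\<lambda>(a, b, c). (a, b)" and j = "\<lambda>(a, b). (a, b, M - a - b)"])
       auto
  finally show ?thesis .
qed

text \<open>Only triples of odd indices contribute, and halving them gives
  \<open>j + k + l + 1 = n\<close>. Written without subtraction, the index set is empty for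
  \<open>n = 0\<close>, as it must be.\<close>

lemma fps_cube_nth_odd:
  fixes f :: "'a::comm_semiring_1 fps"
  assumes "\<And>m. even m \<Longrightarrow> f $ m = 0"
  shows "(f ^ 3) $ (2 * n + 1) = (\<Sum>(j, k, l)\<in>{(j, k, l). j + k + l + 1 = n}.
    f $ (2 * j + 1) * f $ (2 * k + 1) * f $ (2 * l + 1))"
proof -
  let ?h = "\<lambda>(j, k, l). (2 * j + 1, 2 * k + 1, 2 * l + 1 :: nat)"
  let ?I = "{(j, k, l). j + k + l + 1 = n}"
  have mem: "(a, b, c) \<in> ?h ` ?I" if "a + b + c = 2 * n + 1" "odd a" "odd b" "odd c" for a b c
  proof (rule image_eqI[where x = "(a div 2, b div 2, c div 2)"])
    show "(a, b, c) = ?h (a div 2, b div 2, c div 2)"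
      using that by simp
    show "(a div 2, b div 2, c div 2) \<in> ?I"
      using that by (auto elim!: oddE)
  qed
  have "(f ^ 3) $ (2 * n + 1) = (\<Sum>(a, b, c)\<in>?h ` ?I. f $ a * f $ b * f $ c)"
    unfolding fps_cube_nth
  proof (rule sum.mono_neutral_right)
    show "finite {(a, b, c). a + b + c = 2 * n + 1}"
      using finite_sum_triples[of 0] by simp
    show "\<forall>x\<in>{(a, b, c). a + b + c = 2 * n + 1} - ?h ` ?I. (case x of (a, b, c) \<Rightarrow> f $ a * f $ b * f $ c) = 0"
    proof
      fix x assume x: "x \<in> {(a, b, c). a + b + c = 2 * n + 1} - ?h ` ?I"
      obtain a b c where abc: "x = (a, b, c)"
        by (cases x)
      then have "even a \<or> even b \<or> even c"
        using x mem[of a b c] by blast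
      then show "(case x of (a, b, c) \<Rightarrow> f $ a * f $ b * f $ c) = 0"
        using assms abc by auto
    qed
  qed auto
  also have "\<dots> = (\<Sum>(j, k, l)\<in>?I. f $ (2 * j + 1) * f $ (2 * k + 1) * f $ (2 * l + 1))"
    by (subst sum.reindex) (auto simp: inj_on_def intro!: sum.cong)
  finally show ?thesis .
qed

text \<open>Up to a shift, the coefficients of the derivative dominate those of the series in norm.
  This direction carries convergence from the derivative back to its primitive
  \<open>TT\<close>.\<close>

lemma fps_conv_radius_le_deriv:
  fixes f :: "'a::{banach, real_normed_field} fps"
  shows "fps_conv_radius (fps_deriv f) \<le> fps_conv_radius f"
proof -
  have "fps_conv_radius (fps_deriv f) \<le> fps_conv_radius (fps_shift 1 f)"
    unfolding fps_conv_radius_def[of "fps_shift 1 f"]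
  proof (rule conv_radius_geI_ex')
    fix r :: real assume r: "0 < r" "ereal r < fps_conv_radius (fps_deriv f)"
    then have "summable (\<lambda>n. norm (fps_deriv f $ n * of_real r ^ n))"
      by (intro abs_summable_in_conv_radius) (auto simp: fps_conv_radius_def)
    then show "summable (\<lambda>n. fps_shift 1 f $ n * of_real r ^ n)"
    proof (rule summable_comparison_test'[where N = 0])
      fix n
      have "norm (f $ Suc n) * 1 \<le> norm (f $ Suc n) * real (Suc n)"
        by (intro mult_left_mono) auto
      then show "norm (fps_shift 1 f $ n * of_real r ^ n) \<le> norm (fps_deriv f $ n * of_real r ^ n)"
        using mult_right_mono[of _ _ "norm (of_real r ^ n :: 'a)"]
        by (simp add: norm_mult mult.commute[of _ "norm (f $ Suc n)"] del: of_nat_Suc)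
    qed
  qed
  then show ?thesis
    by simp
qed


section \<open>The lemniscate sine\<close>

text \<open>As an injective holomorphic map on the disc, \<open>arcsl\<close> has an open image and
  a holomorphic inverse there, which coincides with \<open>sl\<close>. The derivative of the inverse
  yields the first-order equation.\<close>

lemma sl_has_fps_expansion:
  obtains E where "sl has_fps_expansion E" "fps_expansion sl 0 = E" "E $ 0 = 0" "E $ 1 = 1"
    "fps_deriv E ^ 2 = 1 - E ^ 4"
proof -
  let ?B = "ball 0 1 :: complex set"
  have holo: "arcsl holomorphic_on ?B"
    using arcsl_has_field_derivative by (force simp: holomorphic_on_open)
  obtain g where g: "g holomorphic_on (arcsl ` ?B)"
    "\<And>z. z \<in> ?B \<Longrightarrow> deriv arcsl z * deriv g (arcsl z) = 1" "\<And>z. z \<in> ?B \<Longrightarrow> g (arcsl z) = z"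
    using holomorphic_has_inverse[OF holo open_ball inj_on_arcsl] by metis
  have op: "open (arcsl ` ?B)"
    using open_mapping_thm3[OF holo open_ball inj_on_arcsl] .
  have eq: "g w = sl w" if "w \<in> arcsl ` ?B" for w
    using that g(3) sl_arcsl by auto
  have sl_holo: "sl holomorphic_on (arcsl ` ?B)"
    using g(1) eq by (rule holomorphic_transform)
  have [simp]: "arcsl 0 = 0"
    by (simp add: arcsl_def)
  have zero: "0 \<in> arcsl ` ?B"
    by (rule image_eqI[of _ _ 0]) auto
  have deriv_sl: "deriv sl (arcsl s) = csqrt (1 - s ^ 4)" if s: "s \<in> ?B" for s
  proof -
    have "deriv sl (arcsl s) = deriv g (arcsl s)"
      using s eq by (intro deriv_cong_ev) (auto intro!: eventually_mono[OF eventually_nhds_in_open[OF op]])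
    moreover have "deriv arcsl s = 1 / csqrt (1 - s ^ 4)"
      using arcsl_has_field_derivative[OF s] by (rule DERIV_imp_deriv)
    moreover have "csqrt (1 - s ^ 4) \<noteq> 0"
      using Re_one_minus_power4_pos[OF s] by (auto simp del: csqrt.simps)
    ultimately show ?thesis
      using g(2)[OF s] by (simp add: field_simps del: csqrt.simps)
  qed
  define E where "E = fps_expansion sl 0"
  have E: "sl has_fps_expansion E"
    unfolding E_def using op zero sl_holo by (rule has_fps_expansion_fps_expansion)
  have "sl 0 = 0"
    using sl_arcsl[of 0] by simp
  then have E0: "E $ 0 = 0"
    using fps_nth_fps_expansion[OF E, of 0] by simp
  have "deriv sl 0 = 1"
    using deriv_sl[of 0] by simp
  then have E1: "E $ 1 = 1"
    using fps_nth_fps_expansion[OF E, of 1] by simp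
  have "(\<lambda>z. deriv sl z ^ 2) has_fps_expansion fps_deriv E ^ 2"
    using E by (intro fps_expansion_intros)
  moreover have "(\<lambda>z. 1 - sl z ^ 4) has_fps_expansion 1 - E ^ 4"
    using E by (intro fps_expansion_intros)
  \<comment> \<open>Squaring removes the root from \<open>deriv_sl\<close>. The image of the disc is
    a neighbourhood of 0, and the expansion depends only on the germ.\<close>
  moreover have "eventually (\<lambda>z. deriv sl z ^ 2 = 1 - sl z ^ 4) (nhds 0)"
    using eventually_nhds_in_open[OF op zero]
    by (rule eventually_mono) (auto simp: deriv_sl sl_arcsl simp del: csqrt.simps)
  ultimately have "fps_deriv E ^ 2 = 1 - E ^ 4"
    using fps_expansion_unique_complex has_fps_expansion_cong[OF _ refl] by metis
  with E E0 E1 show ?thesis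
    by (intro that[of E]) (simp_all add: E_def)
qed

text \<open>Differentiation yields a common factor \<open>2 * fps_deriv E\<close>, which can be
  cancelled because it is nonzero and formal power series over a field have no zero
  divisors.\<close>

lemma lemniscate_second_order:
  fixes E :: "'a::field_char_0 fps"
  assumes E: "fps_deriv E ^ 2 = 1 - E ^ 4" and "E $ 1 \<noteq> 0"
  shows "fps_deriv (fps_deriv E) = fps_const (-2) * E ^ 3"
proof -
  have "fps_deriv (fps_deriv E ^ 2) = fps_deriv (1 - E ^ 4)"
    by (simp only: E)
  then have "fps_deriv E * (2 * fps_deriv (fps_deriv E)) = fps_deriv E * (2 * (- (2 * E ^ 3)))"
    by (simp add: power2_eq_square eval_nat_numeral algebra_simps)
  then have "2 * fps_deriv E * (fps_deriv (fps_deriv E) + 2 * E ^ 3) = 0"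
    by (simp add: algebra_simps)
  moreover have "fps_deriv E \<noteq> 0"
  proof
    assume "fps_deriv E = 0"
    then have "fps_deriv E $ 0 = 0"
      by (simp only: fps_zero_nth)
    then show False
      using assms(2) by simp
  qed
  ultimately have "fps_deriv (fps_deriv E) = - (2 * E ^ 3)"
    by (simp del: fps_deriv_eq_0_iff add: add_eq_0_iff2)
  then show ?thesis
    by (simp add: numeral_fps_const flip: fps_const_neg)
qed

text \<open>For constants \<open>a\<close>, \<open>b\<close>, the series \<open>a * E(b z)\<close>
  satisfies the equation with constant 1/2 when \<open>-2 * a * b^2 = a^3 / 2\<close>. Here
  \<open>b = (1 + \<i>) / 2\<close> gives \<open>b^2 = \<i> / 2\<close>, and
  \<open>a = 1 - \<i>\<close> satisfies \<open>a^2 = -4 * b^2\<close>; moreover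
  \<open>a * b = 1\<close>, which normalises the linear coefficient.\<close>

lemma lemniscate_rescaled:
  fixes E :: "complex fps"
  assumes E: "fps_deriv (fps_deriv E) = fps_const (-2) * E ^ 3"
  defines "V \<equiv> fps_const (1 - \<i>) * (E oo (fps_const ((1 + \<i>) / 2) * fps_X))"
  shows "fps_deriv (fps_deriv V) = fps_const (1 / 2) * V ^ 3"
proof -
  define L :: "complex fps" where "L = fps_const ((1 + \<i>) / 2) * fps_X"
  have L: "L $ 0 = 0" "fps_deriv L = fps_const ((1 + \<i>) / 2)"
    by (simp_all add: L_def)
  have "fps_deriv (fps_deriv V) = fps_const ((1 - \<i>) * ((1 + \<i>) / 2) ^ 2) * (fps_deriv (fps_deriv E) oo L)"
    unfolding V_def L_def[symmetric]
    by (simp add: fps_compose_deriv L power2_eq_square mult.commute[of _ "fps_const ((1 + \<i>) / 2)"] mult.assoc[symmetric])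
  also have "fps_deriv (fps_deriv E) oo L = fps_const (-2) * (E oo L) ^ 3"
    by (simp add: E fps_compose_mult_distrib L fps_compose_power)
  also have "fps_const ((1 - \<i>) * ((1 + \<i>) / 2) ^ 2) * (fps_const (-2) * (E oo L) ^ 3) =
      fps_const (((1 - \<i>) * ((1 + \<i>) / 2) ^ 2) * (-2)) * (E oo L) ^ 3"
    by (simp add: mult.assoc flip: fps_const_mult)
  also have "((1 - \<i>) * ((1 + \<i>) / 2) ^ 2) * (-2) = 1 / 2 * (1 - \<i>) ^ 3"
    by (simp add: complex_eq_iff power2_eq_square power3_eq_cube)
  also have "fps_const (1 / 2 * (1 - \<i>) ^ 3) * (E oo L) ^ 3 = fps_const (1 / 2) * V ^ 3"
    by (simp add: V_def L_def[symmetric] power_mult_distrib fps_const_power mult.assoc flip: fps_const_mult)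
  finally show ?thesis .
qed


theorem theorem4p3:
  fixes \<phi> T :: "nat \<Rightarrow> real" and S :: "nat \<Rightarrow> complex" and TT :: "complex fps"
  assumes phi: "\<And>j. \<phi> j = (if even j then 1 / fact j else 0)"
    and T: "\<And>n. n \<ge> 1 \<Longrightarrow>
      T n = (\<Sum>t\<in>ordered_trees n. (\<Prod>v\<in>nodes t. \<phi> (outdeg t v)) * card (increasing_bilabellings t))"
    and TT: "TT = Abs_fps (\<lambda>m. if even m \<and> m \<ge> 2 then complex_of_real (T (m div 2)) / fact m else 0)"
    and S: "\<And>n. S n = (deriv ^^ n) sl 0"
  shows "fps_deriv TT =
      fps_const (1 - \<i>) * (fps_expansion sl 0 oo (fps_const ((1 + \<i>) / 2) * fps_X)) \<and>
    fps_conv_radius TT > 0 \<and>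
    (\<forall>\<^sub>F z in nhds 0. deriv (eval_fps TT) z = (1 - \<i>) * sl ((1 + \<i>) * z / 2)) \<and>
    (\<forall>n\<ge>1. complex_of_real (T n) = (\<i> / 2) ^ (n - 1) * S (2 * n - 1)) \<and>
    (\<forall>n. T (n + 2) = 1 / 2 * (\<Sum>(j, k, l)\<in>{(j, k, l). j + k + l + 1 = n}.
      fact (2 * n + 1) / (fact (2 * j + 1) * fact (2 * k + 1) * fact (2 * l + 1))
        * T (j + 1) * T (k + 1) * T (l + 1))) \<and>
    T 1 = 1"
proof -
  \<comment> \<open>A complex copy of \<open>\<phi>\<close>, so that the tree series lies in the
    same ring as the expansion of \<open>sl\<close>.\<close>
  define \<psi> :: "nat \<Rightarrow> complex" where "\<psi> = (\<lambda>j. if even j then 1 / fact j else 0)"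
  have \<psi>: "\<psi> j = of_real (\<phi> j)" for j
    by (simp add: \<psi>_def phi)
  have TT_eq: "TT = tree_fps \<psi>"
  proof (rule fps_ext)
    fix m
    have zero: "tree_fps \<psi> $ m = 0" if "{t. 2 * card (nodes t) = m} = {}"
      using that by (simp add: tree_fps_def)
    have pos: "2 * card (nodes t) \<ge> 2" for t
      using card_nodes_pos[of t] by linarith
    show "TT $ m = tree_fps \<psi> $ m"
    proof (cases "even m \<and> m \<ge> 2")
      case True
      then obtain n where n: "m = 2 * n" "n \<ge> 1"
        by (auto elim!: evenE)
      have "tree_fps \<psi> $ m = (\<Sum>t\<in>ordered_trees n. tree_weight \<psi> t)"
        by (simp add: tree_fps_def ordered_trees_def n)
      also have "\<dots> = (\<Sum>t\<in>ordered_trees n. complex_of_real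
          ((\<Prod>v\<in>nodes t. \<phi> (outdeg t v)) * card (increasing_bilabellings t)) / fact m)"
        by (rule sum.cong) (auto simp: tree_weight_def bilab_weight_def ordered_trees_def n \<psi>
            increasing_bilabellings_eq_bilab)
      also have "\<dots> = of_real (T n) / fact m"
        unfolding T[OF n(2)] by (simp add: sum_divide_distrib)
      finally show ?thesis
        using True n by (simp add: TT)
    next
      \<comment> \<open>No tree carries an odd number of labels or fewer than two, so the
        coefficients set to 0 in \<open>TT\<close> are the right ones.\<close>
      case False
      then have "{t. 2 * card (nodes t) = m} = {}"
        using pos by auto
      then show ?thesis
        using False zero by (auto simp: TT)
    qed
  qed

  \<comment> \<open>The differential equation and initial values of the derivative\<close>
  define U where "U = fps_deriv TT"
  have TT2: "fps_deriv (fps_deriv TT) = Abs_fps \<psi> oo TT"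
    unfolding TT_eq by (rule fps_deriv_deriv_tree_fps)
  have U_odd: "U $ (2 * n + 1) = of_real (T (n + 1)) / fact (2 * n + 1)" for n
  proof -
    have "U $ (2 * n + 1) = of_nat (Suc (2 * n + 1)) * (of_real (T (n + 1)) / fact (Suc (2 * n + 1)))"
      by (simp add: U_def TT del: fact_Suc of_nat_Suc)
    also have "\<dots> = of_real (T (n + 1)) / fact (2 * n + 1)"
      unfolding fact_Suc[of "2 * n + 1"] by (simp del: of_nat_Suc fact_Suc)
    finally show ?thesis .
  qed
  have U_even: "U $ m = 0" if "even m" for m
    using that by (simp add: U_def TT)
  have ode: "fps_deriv (fps_deriv U) = fps_const (1 / 2) * U ^ 3"
    unfolding U_def using TT2 by (intro fps_cosh_sinh_ode) (simp_all add: \<psi>_def TT)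
  \<comment> \<open>The constant term of \<open>cosh\<close> composed with a series without constant
    term; this gives \<open>T 1\<close> without enumerating trees.\<close>
  have "fps_deriv U $ 0 = 1"
    by (simp add: U_def TT2 \<psi>_def)
  then have U1: "U $ 1 = 1"
    by simp
  have T1: "T 1 = 1"
    using U_odd[of 0] U1 by simp

  \<comment> \<open>Comparison with the rescaled lemniscate sine\<close>
  obtain E where E: "sl has_fps_expansion E" "fps_expansion sl 0 = E" "E $ 0 = 0" "E $ 1 = 1"
    "fps_deriv E ^ 2 = 1 - E ^ 4"
    by (rule sl_has_fps_expansion)
  define V where "V = fps_const (1 - \<i>) * (E oo (fps_const ((1 + \<i>) / 2) * fps_X))"
  have V_nth: "V $ n = (1 - \<i>) * (((1 + \<i>) / 2) ^ n * E $ n)" for n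
    by (simp add: V_def)
  have UV: "U = V"
  proof (rule fps_second_order_ode_unique[OF ode])
    show "fps_deriv (fps_deriv V) = fps_const (1 / 2) * V ^ 3"
      unfolding V_def using E by (intro lemniscate_rescaled lemniscate_second_order) auto
    \<comment> \<open>Both linear coefficients are 1, since
      \<open>(1 - \<i>) * (1 + \<i>) / 2 = 1\<close>.\<close>
    show "U $ 0 = V $ 0" "U $ 1 = V $ 1"
      using U_even[of 0] U1 E by (simp_all add: V_nth complex_eq_iff)
  qed
  have "(\<lambda>z. (1 - \<i>) * (sl \<circ> (\<lambda>z. (1 + \<i>) / 2 * z)) z) has_fps_expansion V"
    unfolding V_def using E by (intro fps_expansion_intros) auto
  then have V_exp: "fps_conv_radius V > 0"
      "\<forall>\<^sub>F z in nhds 0. eval_fps V z = (1 - \<i>) * sl ((1 + \<i>) * z / 2)"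
    by (simp_all add: has_fps_expansion_def)
  have radius: "fps_conv_radius TT > 0"
    using V_exp(1) fps_conv_radius_le_deriv[of TT] UV by (simp add: U_def)
  have "deriv (eval_fps TT) has_fps_expansion V"
    using has_fps_expansion_deriv[OF eval_fps_has_fps_expansion[OF radius]] UV by (simp add: U_def)
  then have "\<forall>\<^sub>F z in nhds 0. eval_fps V z = deriv (eval_fps TT) z"
    by (simp add: has_fps_expansion_def)
  with V_exp(2) have deriv: "\<forall>\<^sub>F z in nhds 0. deriv (eval_fps TT) z = (1 - \<i>) * sl ((1 + \<i>) * z / 2)"
    by eventually_elim simp
  have T_S: "complex_of_real (T n) = (\<i> / 2) ^ (n - 1) * S (2 * n - 1)" if n1: "n \<ge> 1" for n
  proof -
    obtain k where k: "n = k + 1"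
      using n1 by (cases n) auto
    let ?m = "2 * k + 1"
    have 1: "U $ ?m = of_real (T n) / fact ?m"
      unfolding k by (rule U_odd)
    have 2: "E $ ?m = S ?m / fact ?m"
      unfolding S by (rule fps_nth_fps_expansion[OF E(1)])
    have "of_real (T n) / fact ?m = (1 - \<i>) * (((1 + \<i>) / 2) ^ ?m * (S ?m / fact ?m))"
      unfolding 1[symmetric] 2[symmetric] UV by (rule V_nth)
    then have "of_real (T n) = (1 - \<i>) * ((1 + \<i>) / 2) ^ ?m * S ?m"
      by (simp only: mult.assoc[symmetric] times_divide_eq_right divide_cancel_right fact_nonzero simp_thms)
    \<comment> \<open>The odd exponent leaves one factor to cancel against \<open>1 - \<i>\<close>;
      the other \<open>2 * k\<close> factors pair up to powers of \<open>\<i> / 2\<close>.\<close>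
    also have "(1 - \<i>) * ((1 + \<i>) / 2) ^ ?m = (((1 + \<i>) / 2) ^ 2) ^ k * ((1 - \<i>) * ((1 + \<i>) / 2))"
      unfolding power_add power_mult power_one_right by (simp only: mult_ac)
    also have "(1 - \<i>) * ((1 + \<i>) / 2) = 1"
      by (simp add: complex_eq_iff)
    also have "((1 + \<i>) / 2) ^ 2 = \<i> / 2"
      by (simp add: complex_eq_iff power2_eq_square)
    finally show ?thesis
      by (simp add: k)
  qed
  have rec: "T (n + 2) = 1 / 2 * (\<Sum>(j, k, l)\<in>{(j, k, l). j + k + l + 1 = n}.
      fact (2 * n + 1) / (fact (2 * j + 1) * fact (2 * k + 1) * fact (2 * l + 1))
        * T (j + 1) * T (k + 1) * T (l + 1))" (is "_ = 1 / 2 * ?R") for n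
  proof -
    \<comment> \<open>At this index the second derivative picks out coefficient
      \<open>2 * n + 3\<close> of \<open>U\<close>, which holds \<open>T (n + 2)\<close>; the cube
      on the other side then provides the sum.\<close>
    let ?N = "2 * n + 1"
    have "fps_deriv (fps_deriv U) $ ?N =
        of_nat (Suc ?N) * (of_nat (Suc (Suc ?N)) * U $ (2 * (n + 1) + 1))"
      by (simp del: of_nat_Suc)
    also have "\<dots> = of_nat (Suc ?N) * (of_nat (Suc (Suc ?N)) * (of_real (T (n + 2)) / fact (Suc (Suc ?N))))"
      unfolding U_odd by (simp del: of_nat_Suc fact_Suc)
    also have "\<dots> = of_real (T (n + 2)) / fact ?N"
      unfolding fact_Suc[of "Suc ?N"] fact_Suc[of ?N] by (simp del: of_nat_Suc fact_Suc)
    finally have "of_real (T (n + 2)) / fact ?N = 1 / 2 * (U ^ 3) $ ?N"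
      by (simp add: ode del: fact_Suc)
    then have "complex_of_real (T (n + 2)) = 1 / 2 * (fact ?N * (U ^ 3) $ ?N)"
      by (simp add: divide_simps del: fact_Suc)
    also have "(U ^ 3) $ ?N = (\<Sum>(j, k, l)\<in>{(j, k, l). j + k + l + 1 = n}.
        U $ (2 * j + 1) * U $ (2 * k + 1) * U $ (2 * l + 1))"
      by (rule fps_cube_nth_odd[OF U_even])
    also have "fact ?N * \<dots> = of_real ?R"
      unfolding U_odd sum_distrib_left of_real_sum
      by (rule sum.cong) (auto simp: mult_ac simp del: fact_Suc)
    also have "1 / 2 * of_real ?R = complex_of_real (1 / 2 * ?R)"
      by simp
    finally show ?thesis
      unfolding of_real_eq_iff .
  qed
  show ?thesis
    using UV radius deriv T_S rec T1 unfolding U_def V_def E(2) by blast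
qed

end
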